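(* For any $k\ge2$ and any sufficiently large $n$, there exist a finite semimetric space $(X,d)$ with $|X|=n$ and a distribution of $k$-clusterings $(C_1,\ldots,C_k)$ of $X$ that are $(\tfrac12,1)$-convex (with respect to the uniform-radius notion as well as the generalized notion of $(\beta,\gamma)$-convexity, with $\beta=\tfrac12$, $\gamma=1$) such that any algorithm (even randomized) needs $\Omega\big(k\log\frac nk\big)$ SEED and/or same-cluster queries to learn the radii $\epsilon_1,\ldots,\epsilon_k$ of all clusters with constant probability.
   Context: Semimetric: $X$ is a finite set and $d$ is symmetric with $d(x,x)=0$ and $d(x,y)\in(0,\infty]$ for $x\neq y$ (the triangle inequality is not required). The algorithm knows $(X,d)$ and accesses the unknown clustering only through queries. For $\epsilon\ge0$, $G_X(\epsilon)$ is the unweighted undirected graph on $X$ in which distinct $x,y$ are adjacent iff $d(x,y)\le\epsilon$. For a graph $G$, $d_G$ is the shortest-path distance (number of edges; $\infty$ if there is no path). The length of a path is its number of edges. A $k$-clustering of $X$ is a partition $(C_1,\ldots,C_k)$ of $X$. Uniform-radius $(\beta,\gamma)$-convexity: there is $\epsilon>0$ such that for each $i$: (1) the subgraph of $G_X(\epsilon)$ induced by $C_i$ is connected; (2) $d(x,y)>\beta\epsilon$ for all $x\in C_i$, $y\in X\setminus C_i$; (3) if $x,y\in C_i$, every simple path in $G_X(\epsilon)$ between $x$ and $y$ of length at most $(1+\gamma)d_{G_X(\epsilon)}(x,y)$ lies entirely in $C_i$. Generalized $(\beta,\gamma)$-convexity: for each $i$ there is $\epsilon_i>0$ such that: (1)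 the subgraph of $G_X(\epsilon_i)$ induced by $C_i$ is connected; (2) $d(x,y)>\beta\epsilon_i$ for all $x\in C_i$, $y\in X\setminus C_i$; (3) for every $\epsilon\le\epsilon_i$, if $x,y\in C_i$ and $d_{G_X(\epsilon)}(x,y)<\infty$, every simple path in $G_X(\epsilon)$ between $x$ and $y$ of length at most $(1+\gamma)d_{G_X(\epsilon)}(x,y)$ lies entirely in $C_i$. The radius $\epsilon_i$ of the individual cluster $C_i$ is the smallest value such that any two points of $C_i$ are connected by a path in $G_X(\epsilon_i)$ (for a singleton cluster, $0$). Oracles: a same-cluster query takes $x,y\in X$ and returns $1$ if they are in the same cluster and $0$ otherwise. A query SEED$(S,i)$, $S\subseteq X$, $i\in[k]$, returns an arbitrary point of $C_i\cap S$ (the oracle may choose which), or NIL if $C_i\cap S=\emptyset$. *)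

theory Defs
  imports "HOL-Probability.Probability"
begin

section \<open>Semimetric spaces and threshold graphs\<close>

definition semimetric :: "'a set \<Rightarrow> ('a \<Rightarrow> 'a \<Rightarrow> ereal) \<Rightarrow> bool" where
  "semimetric X d \<longleftrightarrow>
     (\<forall>x\<in>X. d x x = 0) \<and>
     (\<forall>x\<in>X. \<forall>y\<in>X. d x y = d y x) \<and>
     (\<forall>x\<in>X. \<forall>y\<in>X. x \<noteq> y \<longrightarrow> 0 < d x y)"

text \<open>Adjacency in the graph \<open>G\<^sub>X(\<epsilon>)\<close>; its vertex set is \<open>X\<close>.\<close>

definition adj :: "'a set \<Rightarrow> ('a \<Rightarrow> 'a \<Rightarrow> ereal) \<Rightarrow> real \<Rightarrow> 'a \<Rightarrow> 'a \<Rightarrow> bool" where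
  "adj X d \<epsilon> x y \<longleftrightarrow> x \<in> X \<and> y \<in> X \<and> x \<noteq> y \<and> d x y \<le> ereal \<epsilon>"

text \<open>A walk is given by its list of vertices; its length is the number of edges,
  one less than the length of that list.\<close>

definition walk :: "'a set \<Rightarrow> ('a \<Rightarrow> 'a \<Rightarrow> bool) \<Rightarrow> 'a \<Rightarrow> 'a \<Rightarrow> 'a list \<Rightarrow> bool" where
  "walk V E x y xs \<longleftrightarrow>
     xs \<noteq> [] \<and> hd xs = x \<and> last xs = y \<and> set xs \<subseteq> V \<and> successively E xs"

definition simple_walk :: "'a set \<Rightarrow> ('a \<Rightarrow> 'a \<Rightarrow> bool) \<Rightarrow> 'a \<Rightarrow> 'a \<Rightarrow> 'a list \<Rightarrow> bool" where
  "simple_walk V E x y xs \<longleftrightarrow> walk V E x y xs \<and> distinct xs"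

definition walk_length :: "'a list \<Rightarrow> nat" where
  "walk_length xs = length xs - 1"

text \<open>The infimum of the empty set in \<^typ>\<open>enat\<close> is \<open>\<infinity>\<close>.\<close>

definition graph_dist :: "'a set \<Rightarrow> ('a \<Rightarrow> 'a \<Rightarrow> bool) \<Rightarrow> 'a \<Rightarrow> 'a \<Rightarrow> enat" where
  "graph_dist V E x y = (INF xs\<in>{xs. walk V E x y xs}. enat (walk_length xs))"

text \<open>Connectedness of the subgraph induced by \<open>C\<close>: the walks must stay in \<open>C\<close>.\<close>

definition induced_connected :: "('a \<Rightarrow> 'a \<Rightarrow> bool) \<Rightarrow> 'a set \<Rightarrow> bool" where
  "induced_connected E C \<longleftrightarrow> (\<forall>x\<in>C. \<forall>y\<in>C. \<exists>xs. walk C E x y xs)"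


section \<open>Clusterings and convexity\<close>

text \<open>A clustering is the tuple \<open>(C 1, \<dots>, C k)\<close>; values of \<open>C\<close> at other indices are irrelevant.\<close>

definition clustering :: "'a set \<Rightarrow> nat \<Rightarrow> (nat \<Rightarrow> 'a set) \<Rightarrow> bool" where
  "clustering X k C \<longleftrightarrow> inj_on C {1..k} \<and> partition_on X (C ` {1..k})"

definition separated :: "'a set \<Rightarrow> ('a \<Rightarrow> 'a \<Rightarrow> ereal) \<Rightarrow> real \<Rightarrow> real \<Rightarrow> 'a set \<Rightarrow> bool" where
  "separated X d \<beta> \<epsilon> C \<longleftrightarrow> (\<forall>x\<in>C. \<forall>y\<in>X - C. ereal (\<beta> * \<epsilon>) < d x y)"

text \<open>Finiteness of the distance costs nothing in the uniform-radius case: points at infinite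
  distance are not joined by any path.\<close>

definition geodesically_closed ::
  "'a set \<Rightarrow> ('a \<Rightarrow> 'a \<Rightarrow> ereal) \<Rightarrow> real \<Rightarrow> real \<Rightarrow> 'a set \<Rightarrow> bool" where
  "geodesically_closed X d \<gamma> \<epsilon> C \<longleftrightarrow>
     (\<forall>x\<in>C. \<forall>y\<in>C. graph_dist X (adj X d \<epsilon>) x y < \<infinity> \<longrightarrow>
       (\<forall>xs. simple_walk X (adj X d \<epsilon>) x y xs \<and>
          ereal (real (walk_length xs)) \<le> ereal (1 + \<gamma>) * ereal_of_enat (graph_dist X (adj X d \<epsilon>) x y)
          \<longrightarrow> set xs \<subseteq> C))"

definition uniform_convex ::
  "'a set \<Rightarrow> ('a \<Rightarrow> 'a \<Rightarrow> ereal) \<Rightarrow> real \<Rightarrow> real \<Rightarrow> nat \<Rightarrow> (nat \<Rightarrow> 'a set) \<Rightarrow> bool" where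
  "uniform_convex X d \<beta> \<gamma> k C \<longleftrightarrow>
     (\<exists>\<epsilon>>0. \<forall>i\<in>{1..k}.
        induced_connected (adj X d \<epsilon>) (C i) \<and>
        separated X d \<beta> \<epsilon> (C i) \<and>
        geodesically_closed X d \<gamma> \<epsilon> (C i))"

definition generalized_convex ::
  "'a set \<Rightarrow> ('a \<Rightarrow> 'a \<Rightarrow> ereal) \<Rightarrow> real \<Rightarrow> real \<Rightarrow> nat \<Rightarrow> (nat \<Rightarrow> 'a set) \<Rightarrow> bool" where
  "generalized_convex X d \<beta> \<gamma> k C \<longleftrightarrow>
     (\<forall>i\<in>{1..k}. \<exists>\<epsilon>\<^sub>i>0.
        induced_connected (adj X d \<epsilon>\<^sub>i) (C i) \<and>
        separated X d \<beta> \<epsilon>\<^sub>i (C i) \<and>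
        (\<forall>\<epsilon>. 0 \<le> \<epsilon> \<and> \<epsilon> \<le> \<epsilon>\<^sub>i \<longrightarrow> geodesically_closed X d \<gamma> \<epsilon> (C i)))"

text \<open>The connecting walks may leave \<open>C\<close>: they live in \<open>G\<^sub>X(\<epsilon>)\<close>.\<close>

definition radius :: "'a set \<Rightarrow> ('a \<Rightarrow> 'a \<Rightarrow> ereal) \<Rightarrow> 'a set \<Rightarrow> real" where
  "radius X d C =
     (LEAST \<epsilon>. 0 \<le> \<epsilon> \<and> (\<forall>x\<in>C. \<forall>y\<in>C. \<exists>xs. walk X (adj X d \<epsilon>) x y xs))"


section \<open>Oracles and query algorithms\<close>

definition same_cluster :: "nat \<Rightarrow> (nat \<Rightarrow> 'a set) \<Rightarrow> 'a \<Rightarrow> 'a \<Rightarrow> bool" where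
  "same_cluster k C x y \<longleftrightarrow> (\<exists>i\<in>{1..k}. x \<in> C i \<and> y \<in> C i)"

text \<open>\<open>s\<close> is an admissible way of answering the SEED queries on \<open>C\<close>; \<^const>\<open>None\<close> is NIL.\<close>

definition seed_oracle ::
  "'a set \<Rightarrow> nat \<Rightarrow> (nat \<Rightarrow> 'a set) \<Rightarrow> ('a set \<Rightarrow> nat \<Rightarrow> 'a option) \<Rightarrow> bool" where
  "seed_oracle X k C s \<longleftrightarrow>
     (\<forall>S i. S \<subseteq> X \<and> i \<in> {1..k} \<longrightarrow>
        (if C i \<inter> S = {} then s S i = None else s S i \<in> Some ` (C i \<inter> S)))"

text \<open>A deterministic adaptive algorithm is a decision tree: each query continues with a subtree
  depending on the answer. A randomized algorithm is a probability distribution on such trees.\<close>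

datatype ('a, 'o) algorithm =
    Output 'o
  | SameCluster 'a 'a "bool \<Rightarrow> ('a, 'o) algorithm"
  | Seed "'a set" nat "'a option \<Rightarrow> ('a, 'o) algorithm"

primrec admissible :: "'a set \<Rightarrow> nat \<Rightarrow> ('a, 'o) algorithm \<Rightarrow> bool" where
  "admissible X k (Output r) \<longleftrightarrow> True"
| "admissible X k (SameCluster x y f) \<longleftrightarrow> x \<in> X \<and> y \<in> X \<and> (\<forall>b. admissible X k (f b))"
| "admissible X k (Seed S i f) \<longleftrightarrow> S \<subseteq> X \<and> i \<in> {1..k} \<and> (\<forall>a. admissible X k (f a))"

primrec result ::
  "('a \<Rightarrow> 'a \<Rightarrow> bool) \<Rightarrow> ('a set \<Rightarrow> nat \<Rightarrow> 'a option) \<Rightarrow> ('a, 'o) algorithm \<Rightarrow> 'o" where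
  "result scq s (Output r) = r"
| "result scq s (SameCluster x y f) = result scq s (f (scq x y))"
| "result scq s (Seed S i f) = result scq s (f (s S i))"

primrec num_queries ::
  "('a \<Rightarrow> 'a \<Rightarrow> bool) \<Rightarrow> ('a set \<Rightarrow> nat \<Rightarrow> 'a option) \<Rightarrow> ('a, 'o) algorithm \<Rightarrow> nat" where
  "num_queries scq s (Output r) = 0"
| "num_queries scq s (SameCluster x y f) = Suc (num_queries scq s (f (scq x y)))"
| "num_queries scq s (Seed S i f) = Suc (num_queries scq s (f (s S i)))"

text \<open>Whatever points the SEED oracle chooses to return, with probability at least \<open>p\<close> over the
  clustering drawn from \<open>D\<close> and the independent internal randomness \<open>A\<close>, the algorithm outputs
  all radii \<open>\<epsilon>\<^sub>1, \<dots>, \<epsilon>\<^sub>k\<close> after at most \<open>q\<close> queries. In particular this holds for every algorithm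
  that never makes more than \<open>q\<close> queries and succeeds with probability at least \<open>p\<close>.\<close>

definition learns_radii ::
  "'a set \<Rightarrow> ('a \<Rightarrow> 'a \<Rightarrow> ereal) \<Rightarrow> nat \<Rightarrow> (nat \<Rightarrow> 'a set) pmf
     \<Rightarrow> ('a, nat \<Rightarrow> real) algorithm pmf \<Rightarrow> nat \<Rightarrow> real \<Rightarrow> bool" where
  "learns_radii X d k D A q p \<longleftrightarrow>
     (\<forall>\<sigma>. (\<forall>C\<in>set_pmf D. seed_oracle X k C (\<sigma> C)) \<longrightarrow>
        p \<le> measure_pmf.prob (pair_pmf D A)
          {(C, t). num_queries (same_cluster k C) (\<sigma> C) t \<le> q \<and>
             (\<forall>i\<in>{1..k}. result (same_cluster k C) (\<sigma> C) t i = radius X d (C i))})"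

end

theory Submission
  imports Defs
begin

text \<open>The space consists of \<open>(k + 1) div 2\<close> disjoint paths, and the first \<open>k div 2\<close> of them are cut
  at independent uniformly random places into two clusters each. All edge weights lie in
  \<open>(n, 2n]\<close>, so every such cut is convex at scale \<open>2n\<close>; since the weights increase along a path, the
  radius of an initial segment reveals where it ends. A SEED oracle that returns the first point of
  \<open>S\<close> for an initial segment and the last one for a final segment has only two possible
  answers to each query. An algorithm with \<open>q\<close> queries thus produces at most \<open>2 ^ q\<close> different
  outputs, whereas \<open>(m - 1) ^ (k div 2)\<close> outputs are needed, \<open>m \<approx> 2n / k\<close> being the number of points
  on a path.\<close>

section \<open>Walks along the integers\<close>

text \<open>A discrete intermediate value theorem: steps of size one cannot jump over
  \<open>z\<close>.\<close>

lemma unit_steps_intermediate: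
  fixes xs :: "nat list"
  assumes "successively E xs" "\<And>u v. E u v \<Longrightarrow> v = Suc u \<or> u = Suc v" "xs \<noteq> []"
    and "min (hd xs) (last xs) \<le> z" "z \<le> max (hd xs) (last xs)"
  shows "z \<in> set xs"
  using assms
proof (induction xs rule: induct_list012)
  case (3 x y zs)
  then have step: "y = Suc x \<or> x = Suc y" and succ: "successively E (y # zs)"
    by auto
  show ?case
  proof (cases "z = x")
    case False
    have "last (x # y # zs) = last (y # zs)"
      by simp
    then have "min y (last (y # zs)) \<le> z" "z \<le> max y (last (y # zs))"
      using step False "3.prems"(4,5) unfolding list.sel by linarith+
    then show ?thesis
      using "3.IH"(2)[OF succ 3(4)] by simp
  qed simp
qed auto

text \<open>A step away from the last vertex would force the list to pass through its head again,
  against distinctness. Hence each step shrinks the interval spanned by the current vertex and the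
  last one.\<close>

lemma unit_steps_distinct_between:
  fixes xs :: "nat list"
  assumes "successively E xs" "\<And>u v. E u v \<Longrightarrow> v = Suc u \<or> u = Suc v" "xs \<noteq> []" "distinct xs"
  shows "set xs \<subseteq> {min (hd xs) (last xs)..max (hd xs) (last xs)}"
  using assms
proof (induction xs rule: induct_list012)
  case (3 x y zs)
  then have step: "y = Suc x \<or> x = Suc y" and succ: "successively E (y # zs)"
    by auto
  have "x \<notin> set (y # zs)"
    using "3.prems" by auto
  then have out: "\<not> (min y (last (y # zs)) \<le> x \<and> x \<le> max y (last (y # zs)))"
    using unit_steps_intermediate[OF succ 3(4), of x] by auto
  have "set (y # zs) \<subseteq> {min y (last (y # zs))..max y (last (y # zs))}"
    using "3.IH"(2)[OF succ 3(4)] "3.prems" by auto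
  moreover have "min x (last (y # zs)) \<le> min y (last (y # zs))"
    "max y (last (y # zs)) \<le> max x (last (y # zs))"
    using out step by (auto simp: min_def max_def split: if_splits)
  ultimately have "set (y # zs) \<subseteq> {min x (last (y # zs))..max x (last (y # zs))}"
    by (meson atLeastatMost_subset_iff order_trans)
  then show ?case
    by (simp only: list.set(2)[of x] list.sel last_ConsR[OF list.distinct(2)]) simp
qed auto

lemma walk_upt:
  assumes "x \<le> y" "{x..y} \<subseteq> V" "\<And>z. x \<le> z \<Longrightarrow> z < y \<Longrightarrow> E z (Suc z)"
  shows "walk V E x y [x..<Suc y]"
proof -
  have "successively E [x..<Suc y]"
    using assms(3) by (auto simp: successively_conv_nth simp del: upt_Suc)
  then show ?thesis
    using assms(1,2) by (auto simp: walk_def hd_append)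
qed

lemma walk_rev:
  assumes "walk V E x y xs" "\<And>u v. E u v \<Longrightarrow> E v u"
  shows "walk V E y x (rev xs)"
proof -
  have "successively (\<lambda>u v. E v u) xs"
    using assms by (auto simp: walk_def elim: successively_mono)
  then show ?thesis
    using assms(1) by (auto simp: walk_def hd_rev last_rev)
qed

text \<open>Serves the lower bound on a radius: a threshold that lets a walk leave \<open>x\<close>
  must admit an edge at \<open>x\<close>.\<close>

lemma walk_first_step:
  assumes "walk V E x y xs" "x \<noteq> y"
  obtains z where "E x z"
proof -
  from assms obtain z zs where "xs = x # z # zs"
    by (cases xs; cases "tl xs") (auto simp: walk_def)
  then show thesis
    using assms that by (auto simp: walk_def)
qed

section \<open>Counting the outputs of a query algorithm\<close>

text \<open>A same-cluster query has two answers and, by \<open>two\<close>, so does each SEED query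
  over all of \<open>I\<close>. The reachable part of the tree is therefore binary, and runs of at
  most \<open>q\<close> queries end in at most \<open>2 ^ q\<close> leaves.\<close>

lemma two_answers_results:
  fixes t :: "('a, 'b) algorithm" and scq :: "'c \<Rightarrow> 'a \<Rightarrow> 'a \<Rightarrow> bool" and \<sigma> :: "'c \<Rightarrow> 'a set \<Rightarrow> nat \<Rightarrow> 'a option"
  assumes two: "\<And>S i. \<exists>a. \<forall>c\<in>I. \<sigma> c S i \<in> {None, Some a}"
  shows "finite {result (scq c) (\<sigma> c) t |c. c \<in> I \<and> num_queries (scq c) (\<sigma> c) t \<le> q} \<and>
    card {result (scq c) (\<sigma> c) t |c. c \<in> I \<and> num_queries (scq c) (\<sigma> c) t \<le> q} \<le> 2 ^ q"
proof -
  define R where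
    "R t q = {result (scq c) (\<sigma> c) t |c. c \<in> I \<and> num_queries (scq c) (\<sigma> c) t \<le> q}"
    for t :: "('a, 'b) algorithm" and q
  have union: "finite B \<and> card B \<le> 2 ^ Suc r"
    if "B \<subseteq> R t r \<union> R u r" "finite (R t r) \<and> card (R t r) \<le> 2 ^ r"
      "finite (R u r) \<and> card (R u r) \<le> 2 ^ r" for B r and t u :: "('a, 'b) algorithm"
  proof -
    have "finite (R t r \<union> R u r)"
      using that by simp
    moreover have "card (R t r \<union> R u r) \<le> 2 ^ r + 2 ^ r"
      using that by (intro order_trans[OF card_Un_le] add_mono) auto
    ultimately show ?thesis
      using that(1) card_mono[of "R t r \<union> R u r" B] finite_subset[of B] by force
  qed
  have "finite (R t q) \<and> card (R t q) \<le> 2 ^ q"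
  proof (induction t arbitrary: q)
    case (Output r)
    have "R (Output r) q \<subseteq> {r}"
      by (auto simp: R_def)
    then show ?case
      by (metis card_mono card.empty card_insert_disjoint empty_iff finite.simps finite_subset
          le_trans one_le_numeral one_le_power One_nat_def)
  next
    case (SameCluster x y f)
    show ?case
    proof (cases q)
      case 0
      then have "R (SameCluster x y f) q = {}"
        by (auto simp: R_def)
      then show ?thesis
        by simp
    next
      case (Suc r)
      have "result (scq c) (\<sigma> c) (SameCluster x y f) \<in> R (f True) r \<union> R (f False) r"
        if "c \<in> I" "num_queries (scq c) (\<sigma> c) (SameCluster x y f) \<le> q" for c
        using that Suc by (cases "scq c x y") (auto simp: R_def)
      then have "R (SameCluster x y f) q \<subseteq> R (f True) r \<union> R (f False) r"
        by (subst R_def) blast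
      then show ?thesis
        unfolding Suc by (rule union) (rule SameCluster.IH, rule rangeI)+
    qed
  next
    case (Seed S i f)
    show ?case
    proof (cases q)
      case 0
      then have "R (Seed S i f) q = {}"
        by (auto simp: R_def)
      then show ?thesis
        by simp
    next
      case (Suc r)
      \<comment> \<open>The candidate \<open>a\<close> depends on the query and not on
        \<open>c\<close>, so the same two subtrees serve all of \<open>I\<close>.\<close>
      obtain a where a: "\<And>c. c \<in> I \<Longrightarrow> \<sigma> c S i \<in> {None, Some a}"
        using two by blast
      have "result (scq c) (\<sigma> c) (Seed S i f) \<in> R (f None) r \<union> R (f (Some a)) r"
        if "c \<in> I" "num_queries (scq c) (\<sigma> c) (Seed S i f) \<le> q" for c
        using that Suc a[OF that(1)] by (cases "\<sigma> c S i = None") (auto simp: R_def)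
      then have "R (Seed S i f) q \<subseteq> R (f None) r \<union> R (f (Some a)) r"
        by (subst R_def) blast
      then show ?thesis
        unfolding Suc by (rule union) (rule Seed.IH, rule rangeI)+
    qed
  qed
  then show ?thesis
    unfolding R_def .
qed

text \<open>The averaging half of Yao's principle: with the internal randomness drawn first, the
  probability is a mean over deterministic trees \<open>t\<close>, each contributing at most
  \<open>b\<close>.\<close>

lemma prob_pair_pmf_le:
  assumes "\<And>t. measure_pmf.prob D {c. (c, t) \<in> E} \<le> b"
  shows "measure_pmf.prob (pair_pmf D A) E \<le> b"
proof -
  have "pair_pmf D A = bind_pmf A (\<lambda>t. map_pmf (\<lambda>c. (c, t)) D)"
    unfolding pair_pmf_def map_pmf_def by (rule bind_commute_pmf)
  then have "emeasure (pair_pmf D A) E = (\<integral>\<^sup>+ t. emeasure (map_pmf (\<lambda>c. (c, t)) D) E \<partial>A)"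
    by (simp add: emeasure_bind_pmf)
  also have "\<dots> \<le> (\<integral>\<^sup>+ t. ennreal b \<partial>A)"
    using assms
    by (intro nn_integral_mono)
      (auto simp: measure_pmf.emeasure_eq_measure vimage_def intro!: ennreal_leI)
  also have "\<dots> = ennreal b"
    by simp
  finally have "ennreal (measure_pmf.prob (pair_pmf D A) E) \<le> ennreal b"
    by (simp add: measure_pmf.emeasure_eq_measure)
  moreover have "0 \<le> b"
    using assms measure_nonneg order_trans by blast
  ultimately show ?thesis
    by (simp add: ennreal_le_iff)
qed

section \<open>Randomly cut paths\<close>

definition block_length :: "nat \<Rightarrow> nat \<Rightarrow> nat" where
  "block_length k n = n div ((k + 1) div 2)"

text \<open>The last block also receives the points left over by the division.\<close>

definition block :: "nat \<Rightarrow> nat \<Rightarrow> nat \<Rightarrow> nat" where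
  "block k n x = min (x div block_length k n) ((k - 1) div 2)"

text \<open>The summand \<open>n\<close> pushes every edge weight above half of the scale
  \<open>2 * n\<close>; the summand \<open>max x y\<close> makes the weights increase along a path,
  so that a weight identifies its edge.\<close>

definition path_dist :: "nat \<Rightarrow> nat \<Rightarrow> nat \<Rightarrow> nat \<Rightarrow> ereal" where
  "path_dist k n x y =
     (if x = y then 0
      else if block k n x = block k n y \<and> (y = Suc x \<or> x = Suc y) then ereal (real (n + max x y))
      else \<infinity>)"

text \<open>A cut is the first point of the final segment, so the open interval leaves both segments
  nonempty. The extensional product gives each choice of cuts exactly one representative.\<close>

definition cuts :: "nat \<Rightarrow> nat \<Rightarrow> (nat \<Rightarrow> nat) set" where
  "cuts k n = (\<Pi>\<^sub>E b\<in>{..<k div 2}. {b * block_length k n<..<Suc b * block_length k n})"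

text \<open>Block \<open>b\<close> carries the clusters \<open>2 b + 1\<close> (before the cut) and \<open>2 b + 2\<close> (after the cut); for
  odd \<open>k\<close> the last block is not cut.\<close>

definition cut_cluster :: "nat \<Rightarrow> nat \<Rightarrow> (nat \<Rightarrow> nat) \<Rightarrow> nat \<Rightarrow> nat set" where
  "cut_cluster k n s i =
     {x. x < n \<and> block k n x = (i - 1) div 2 \<and>
        (((i - 1) div 2 < k div 2 \<longrightarrow> x < s ((i - 1) div 2)) \<longleftrightarrow> even (i - 1))}"

text \<open>The adversary's oracle: it returns the point of \<open>S\<close> farthest from the cut,
  which says nothing about the cut beyond the fact that the segment meets \<open>S\<close>.\<close>

definition extreme_seed :: "(nat \<Rightarrow> nat set) \<Rightarrow> nat set \<Rightarrow> nat \<Rightarrow> nat option" where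
  "extreme_seed C S i =
     (if C i \<inter> S = {} then None
      else Some (if even (i - 1) then Min (C i \<inter> S) else Max (C i \<inter> S)))"

section \<open>Convexity of the cut clusters\<close>

lemma finite_cut_cluster [simp]: "finite (cut_cluster k n s i)"
  by (rule finite_subset[of _ "{..<n}"]) (auto simp: cut_cluster_def)

lemma block_mono: "x \<le> y \<Longrightarrow> block k n x \<le> block k n y"
  unfolding block_def by (intro min.mono div_le_mono order_refl)

text \<open>Monotonicity of \<open>block\<close> places \<open>z\<close> in the same block, and each
  side of a cut is order convex.\<close>

lemma cut_cluster_between:
  assumes "x \<in> cut_cluster k n s i" "y \<in> cut_cluster k n s i" "x \<le> z" "z \<le> y"
  shows "z \<in> cut_cluster k n s i"
proof -
  have "block k n z = (i - 1) div 2"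
    using assms block_mono[of x z k n] block_mono[of z y k n] by (auto simp: cut_cluster_def)
  then show ?thesis
    using assms by (auto simp: cut_cluster_def)
qed

lemma semimetric_path_dist: "semimetric {..<n} (path_dist k n)"
  by (auto simp: semimetric_def path_dist_def)

lemma path_dist_gt: "x \<noteq> y \<Longrightarrow> ereal (real n) < path_dist k n x y"
  by (auto simp: path_dist_def)

lemma adj_path_distD:
  assumes "adj {..<n} (path_dist k n) \<epsilon> x y"
  shows "y = Suc x \<or> x = Suc y" "real (n + max x y) \<le> \<epsilon>"
  using assms by (auto simp: adj_def path_dist_def split: if_splits)

lemma adj_path_dist_commute:
  "adj {..<n} (path_dist k n) \<epsilon> x y \<Longrightarrow> adj {..<n} (path_dist k n) \<epsilon> y x"
  by (auto simp: adj_def path_dist_def max.commute split: if_splits)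

text \<open>Running through consecutive integers stays in the cluster by order convexity, and the
  heaviest edge met is the one ending in \<open>max x y\<close>.\<close>

lemma cut_cluster_walk:
  assumes x: "x \<in> cut_cluster k n s i" and y: "y \<in> cut_cluster k n s i"
    and \<epsilon>: "real (n + max x y) \<le> \<epsilon>"
  shows "\<exists>xs. walk (cut_cluster k n s i) (adj {..<n} (path_dist k n) \<epsilon>) x y xs"
proof -
  let ?C = "cut_cluster k n s i" and ?E = "adj {..<n} (path_dist k n) \<epsilon>"
  have up: "\<exists>xs. walk ?C ?E u v xs"
    if "u \<le> v" "u \<in> ?C" "v \<in> ?C" "real (n + v) \<le> \<epsilon>" for u v
  proof -
    have sub: "{u..v} \<subseteq> ?C"
      using cut_cluster_between[OF that(2,3)] by auto
    have "?E z (Suc z)" if "u \<le> z" "z < v" for z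
    proof -
      have "z \<in> ?C" "Suc z \<in> ?C"
        using sub that by auto
      moreover have "real (n + Suc z) \<le> real (n + v)"
        using that by linarith
      then have "real (n + Suc z) \<le> \<epsilon>"
        using \<open>real (n + v) \<le> \<epsilon>\<close> by linarith
      ultimately show ?thesis
        by (auto simp: adj_def path_dist_def cut_cluster_def max_def)
    qed
    then show ?thesis
      using walk_upt[OF \<open>u \<le> v\<close> sub] by blast
  qed
  show ?thesis
  proof (cases "x \<le> y")
    case True
    then show ?thesis
      using up x y \<epsilon> by (simp add: max_def)
  next
    case False
    then obtain xs where "walk ?C ?E y x xs"
      using up[of y x] x y \<epsilon> by (auto simp: max_def)
    then show ?thesis
      using walk_rev adj_path_dist_commute by meson
  qed
qed

lemma induced_connected_cut_cluster:
  "induced_connected (adj {..<n} (path_dist k n) (2 * real n)) (cut_cluster k n s i)"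
  unfolding induced_connected_def
  by (intro ballI cut_cluster_walk) (auto simp: cut_cluster_def)

text \<open>Half of \<open>2 * n\<close> is \<open>n\<close>, and any two distinct points are
  farther apart than that.\<close>

lemma separated_cut_cluster:
  "separated {..<n} (path_dist k n) (1/2) (2 * real n) (cut_cluster k n s i)"
  by (auto simp: separated_def intro: path_dist_gt)

text \<open>Edges join consecutive integers, so a simple walk visits only integers between its ends,
  and these lie in the cluster by order convexity.\<close>

lemma geodesically_closed_cut_cluster:
  "geodesically_closed {..<n} (path_dist k n) \<gamma> \<epsilon> (cut_cluster k n s i)"
  unfolding geodesically_closed_def
proof (intro ballI impI allI, elim conjE)
  fix x y xs
  assume x: "x \<in> cut_cluster k n s i" and y: "y \<in> cut_cluster k n s i"
    and "simple_walk {..<n} (adj {..<n} (path_dist k n) \<epsilon>) x y xs"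
  then have "set xs \<subseteq> {min x y..max x y}"
    using unit_steps_distinct_between[of "adj {..<n} (path_dist k n) \<epsilon>" xs, OF _ adj_path_distD(1)]
    by (auto simp: simple_walk_def walk_def)
  moreover have "{min x y..max x y} \<subseteq> cut_cluster k n s i"
    using cut_cluster_between[OF x y] cut_cluster_between[OF y x]
    by (auto simp: min_def max_def split: if_splits)
  ultimately show "set xs \<subseteq> cut_cluster k n s i"
    by blast
qed

section \<open>The adversarial SEED oracle\<close>

lemma seed_oracle_extreme_seed:
  assumes "\<And>i. finite (C i)"
  shows "seed_oracle X k C (extreme_seed C)"
proof -
  have "Min (C i \<inter> S) \<in> C i \<inter> S" "Max (C i \<inter> S) \<in> C i \<inter> S" if "C i \<inter> S \<noteq> {}" for i S
    using that assms by (auto intro: Min_in Max_in simp del: Int_iff)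
  then show ?thesis
    by (auto simp: seed_oracle_def extreme_seed_def)
qed

text \<open>Let \<open>T\<close> be the part of \<open>S\<close> in the block. An initial segment
  that meets \<open>S\<close> contains \<open>Min T\<close>, and a final segment that meets
  \<open>S\<close> contains \<open>Max T\<close>; neither point depends on \<open>s\<close>.\<close>

lemma extreme_seed_two_answers:
  "\<exists>a. \<forall>s. extreme_seed (cut_cluster k n s) S i \<in> {None, Some a}"
proof -
  define T where "T = {x\<in>S. x < n \<and> block k n x = (i - 1) div 2}"
  have fin: "finite T"
    by (rule finite_subset[of _ "{..<n}"]) (auto simp: T_def)
  have sub: "cut_cluster k n s i \<inter> S \<subseteq> T" for s
    by (auto simp: cut_cluster_def T_def)
  show ?thesis
  proof (cases "even (i - 1)")
    case True
    have "Min (cut_cluster k n s i \<inter> S) = Min T" if ne: "cut_cluster k n s i \<inter> S \<noteq> {}" for s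
    proof (rule Min_eqI)
      obtain x where x: "x \<in> cut_cluster k n s i \<inter> S"
        using ne by blast
      then have "x \<in> T"
        using sub by blast
      then have le: "Min T \<le> x" and "Min T \<in> T"
        using fin Min_in[of T] by (auto simp del: Min_in)
      then have "Min T \<in> S" "Min T < n" "block k n (Min T) = (i - 1) div 2"
        unfolding T_def by blast+
      then show "Min T \<in> cut_cluster k n s i \<inter> S"
        using x le True unfolding cut_cluster_def by auto
    qed (use fin sub in \<open>auto simp: subset_iff\<close>)
    then show ?thesis
      using True by (intro exI[of _ "Min T"]) (auto simp: extreme_seed_def)
  next
    case False
    have "Max (cut_cluster k n s i \<inter> S) = Max T" if ne: "cut_cluster k n s i \<inter> S \<noteq> {}" for s
    proof (rule Max_eqI)
      obtain x where x: "x \<in> cut_cluster k n s i \<inter> S"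
        using ne by blast
      then have "x \<in> T"
        using sub by blast
      then have le: "x \<le> Max T" and "Max T \<in> T"
        using fin Max_in[of T] by (auto simp del: Max_in)
      then have "Max T \<in> S" "Max T < n" "block k n (Max T) = (i - 1) div 2"
        unfolding T_def by blast+
      then show "Max T \<in> cut_cluster k n s i \<inter> S"
        using x le False unfolding cut_cluster_def by auto
    qed (use fin sub in \<open>auto simp: subset_iff\<close>)
    then show ?thesis
      using False by (intro exI[of _ "Max T"]) (auto simp: extreme_seed_def)
  qed
qed

section \<open>The cut clusters form a clustering\<close>

locale cut_paths =
  fixes k n :: nat
  assumes k: "2 \<le> k" and n: "2 \<le> block_length k n"
begin

lemma n_pos: "0 < n"
  using n by (cases n) (auto simp: block_length_def)

lemma uniform_convex_cut_cluster:
  "uniform_convex {..<n} (path_dist k n) (1/2) 1 k (cut_cluster k n s)"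
  unfolding uniform_convex_def using n_pos
  by (intro exI[of _ "2 * real n"] conjI ballI induced_connected_cut_cluster
      separated_cut_cluster geodesically_closed_cut_cluster) auto

lemma generalized_convex_cut_cluster:
  "generalized_convex {..<n} (path_dist k n) (1/2) 1 k (cut_cluster k n s)"
  unfolding generalized_convex_def using n_pos
  by (intro ballI exI[of _ "2 * real n"] conjI allI impI induced_connected_cut_cluster
      separated_cut_cluster geodesically_closed_cut_cluster) auto

lemma block_eqI:
  assumes "b * block_length k n \<le> x" "x < Suc b * block_length k n" "b \<le> (k - 1) div 2"
  shows "block k n x = b"
proof -
  have "x div block_length k n = b"
    using assms by (intro div_nat_eqI) (auto simp: mult.commute)
  then show ?thesis
    using assms by (simp add: block_def)
qed

text \<open>The index \<open>(k - 1) div 2\<close> is one less than the number of blocks, so all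
  blocks of nominal length fit below \<open>n\<close>.\<close>

lemma block_end_le:
  assumes "b \<le> (k - 1) div 2"
  shows "Suc b * block_length k n \<le> n"
proof -
  have "Suc b \<le> (k + 1) div 2"
    using assms k by linarith
  then have "Suc b * block_length k n \<le> ((k + 1) div 2) * block_length k n"
    by (rule mult_le_mono1)
  also have "\<dots> \<le> n"
    by (simp add: block_length_def)
  finally show ?thesis .
qed

lemma cutsD:
  assumes "s \<in> cuts k n" "b < k div 2"
  shows "b * block_length k n < s b" "s b < Suc b * block_length k n" "b \<le> (k - 1) div 2"
  using assms by (auto simp: cuts_def PiE_iff)

text \<open>An initial segment contains the first point of its block, a final segment contains the
  cut itself.\<close>

lemma cut_cluster_nonempty:
  assumes s: "s \<in> cuts k n" and i: "i \<in> {1..k}"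
  shows "cut_cluster k n s i \<noteq> {}"
proof -
  define b where "b = (i - 1) div 2"
  have b: "b \<le> (k - 1) div 2"
    using i by (auto simp: b_def intro: div_le_mono)
  show ?thesis
  proof (cases "even (i - 1)")
    case True
    have "b * block_length k n \<in> cut_cluster k n s i"
      unfolding cut_cluster_def b_def[symmetric]
      using True block_eqI[OF _ _ b, of "b * block_length k n"] block_end_le[OF b] n
        cutsD(1)[OF s, of b] by auto
    then show ?thesis
      by blast
  next
    case False
    \<comment> \<open>Odd \<open>i - 1\<close> means \<open>i = 2 * b + 2\<close>, and
      \<open>i \<le> k\<close> then says that block \<open>b\<close> really is cut.\<close>
    then have "b < k div 2"
      using i unfolding b_def atLeastAtMost_iff by presburger
    then have "s b \<in> cut_cluster k n s i"
      unfolding cut_cluster_def b_def[symmetric]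
      using False block_eqI[OF _ _ b, of "s b"] block_end_le[OF b] cutsD[OF s, of b] by auto
    then show ?thesis
      by blast
  qed
qed

lemma cut_cluster_disjoint:
  assumes "i \<in> {1..k}" "j \<in> {1..k}" "x \<in> cut_cluster k n s i" "x \<in> cut_cluster k n s j"
  shows "i = j"
proof -
  have "(i - 1) div 2 = (j - 1) div 2" "even (i - 1) \<longleftrightarrow> even (j - 1)"
    using assms(3,4) by (auto simp: cut_cluster_def)
  \<comment> \<open>A natural number is determined by its half and its parity.\<close>
  then have "i - 1 = j - 1"
    by (metis bit_eq_rec)
  then show ?thesis
    using assms(1,2) by auto
qed

lemma cut_cluster_cover:
  assumes "x < n"
  shows "\<exists>i\<in>{1..k}. x \<in> cut_cluster k n s i"
proof -
  define b where "b = block k n x"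
  have b: "b \<le> (k - 1) div 2"
    by (simp add: b_def block_def)
  show ?thesis
  proof (cases "b < k div 2 \<longrightarrow> x < s b")
    case True
    then show ?thesis
      using assms b k by (intro bexI[of _ "2 * b + 1"]) (auto simp: cut_cluster_def b_def)
  next
    case False
    \<comment> \<open>The failed implication includes \<open>b < k div 2\<close>, which puts the
      index \<open>2 * b + 2\<close> within range.\<close>
    then show ?thesis
      using assms by (intro bexI[of _ "2 * b + 2"]) (auto simp: cut_cluster_def b_def)
  qed
qed

lemma clustering_cut_cluster:
  assumes "s \<in> cuts k n"
  shows "clustering {..<n} k (cut_cluster k n s)"
  unfolding clustering_def
proof
  show "inj_on (cut_cluster k n s) {1..k}"
    using cut_cluster_nonempty[OF assms] cut_cluster_disjoint by (intro inj_onI) blast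
  show "partition_on {..<n} (cut_cluster k n s ` {1..k})"
  proof (rule partition_onI)
    show "\<Union> (cut_cluster k n s ` {1..k}) = {..<n}"
      using cut_cluster_cover by (auto simp: cut_cluster_def)
    show "disjnt p q" if "p \<in> cut_cluster k n s ` {1..k}" "q \<in> cut_cluster k n s ` {1..k}" "p \<noteq> q"
      for p q
      using that cut_cluster_disjoint by (fastforce simp: disjnt_def)
    show "{} \<notin> cut_cluster k n s ` {1..k}"
      using cut_cluster_nonempty[OF assms] by force
  qed
qed

section \<open>Radii of the initial segments\<close>

lemma cut_cluster_before_eq:
  assumes s: "s \<in> cuts k n" and b: "b < k div 2"
  shows "cut_cluster k n s (2 * b + 1) = {b * block_length k n..<s b}"
proof
  show "{b * block_length k n..<s b} \<subseteq> cut_cluster k n s (2 * b + 1)"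
    using cutsD[OF s b] block_end_le[of b] block_eqI[of b] by (auto simp: cut_cluster_def b)
  \<comment> \<open>Truncation by \<open>min\<close> only lowers the quotient, so no point of block
    \<open>b\<close>, leftover points included, lies before the nominal start of the block.\<close>
  have "b * block_length k n \<le> x" if "block k n x = b" for x
  proof -
    have "b \<le> x div block_length k n"
      using that by (auto simp: block_def)
    then show ?thesis
      using n by (simp add: less_eq_div_iff_mult_less_eq)
  qed
  then show "cut_cluster k n s (2 * b + 1) \<subseteq> {b * block_length k n..<s b}"
    by (auto simp: cut_cluster_def b)
qed

text \<open>The last point \<open>s b - 1\<close> can be reached only over an edge of weight at
  least \<open>n + (s b - 1)\<close>, and this threshold already connects the segment. A singleton
  needs no edge, hence radius \<open>0\<close>.\<close>

lemma radius_before_cut: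
  assumes s: "s \<in> cuts k n" and b: "b < k div 2"
  shows "radius {..<n} (path_dist k n) (cut_cluster k n s (2 * b + 1)) =
    (if s b = Suc (b * block_length k n) then 0 else real (n + (s b - 1)))"
proof -
  let ?a = "b * block_length k n" and ?C = "cut_cluster k n s (2 * b + 1)"
  have C: "?C = {?a..<s b}" and a: "?a < s b"
    using cut_cluster_before_eq[OF s b] cutsD(1)[OF s b] .
  have sub: "?C \<subseteq> {..<n}"
    by (auto simp: cut_cluster_def)
  show ?thesis
  proof (cases "s b = Suc ?a")
    case True
    then have "?C = {?a}" "?a < n"
      using C sub by auto
    then have "\<exists>xs. walk {..<n} (adj {..<n} (path_dist k n) 0) x y xs" if "x \<in> ?C" "y \<in> ?C" for x y
      using that by (intro exI[of _ "[?a]"]) (auto simp: walk_def)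
    then have "radius {..<n} (path_dist k n) ?C = 0"
      unfolding radius_def by (intro Least_equality) auto
    then show ?thesis
      using True by simp
  next
    case False
    have conn: "\<exists>xs. walk {..<n} (adj {..<n} (path_dist k n) (real (n + (s b - 1)))) x y xs"
      if "x \<in> ?C" "y \<in> ?C" for x y
    proof -
      have "max x y \<le> s b - 1"
        using that unfolding C by auto
      then have "real (n + max x y) \<le> real (n + (s b - 1))"
        by linarith
      from cut_cluster_walk[OF that this]
      obtain xs where "walk ?C (adj {..<n} (path_dist k n) (real (n + (s b - 1)))) x y xs"
        by blast
      then have "walk {..<n} (adj {..<n} (path_dist k n) (real (n + (s b - 1)))) x y xs"
        using sub by (simp add: walk_def subset_trans[of _ ?C])
      then show ?thesis
        by blast
    qed
    have least: "real (n + (s b - 1)) \<le> \<epsilon>"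
      if "\<forall>x\<in>?C. \<forall>y\<in>?C. \<exists>xs. walk {..<n} (adj {..<n} (path_dist k n) \<epsilon>) x y xs" for \<epsilon>
    proof -
      have "s b - 1 \<in> ?C" "?a \<in> ?C" "s b - 1 \<noteq> ?a"
        unfolding C using a False by (simp, simp, linarith)
      with that obtain xs where "walk {..<n} (adj {..<n} (path_dist k n) \<epsilon>) (s b - 1) ?a xs"
        by blast
      \<comment> \<open>Whichever neighbour \<open>y\<close> is, the edge weighs at least
        \<open>n + (s b - 1)\<close>.\<close>
      then obtain y where "adj {..<n} (path_dist k n) \<epsilon> (s b - 1) y"
        using \<open>s b - 1 \<noteq> ?a\<close> by (rule walk_first_step)
      then have "real (n + max (s b - 1) y) \<le> \<epsilon>"
        by (rule adj_path_distD)
      then show ?thesis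
        by (simp add: max_def split: if_splits)
    qed
    have "radius {..<n} (path_dist k n) ?C = real (n + (s b - 1))"
      unfolding radius_def
    proof (rule Least_equality, goal_cases)
      case 1
      show ?case
        using conn by simp
    next
      case (2 \<epsilon>)
      then show ?case
        using least by simp
    qed
    then show ?thesis
      using False by simp
  qed
qed

text \<open>The radii of the initial segments suffice: \<open>n + (s b - 1)\<close> reveals
  \<open>s b\<close>, and the singleton value \<open>0\<close> cannot be confused with it because
  \<open>n\<close> is positive.\<close>

lemma cuts_eqI:
  assumes s: "s \<in> cuts k n" and t: "t \<in> cuts k n"
    and eq: "\<And>i. i \<in> {1..k} \<Longrightarrow> radius {..<n} (path_dist k n) (cut_cluster k n s i) =
      radius {..<n} (path_dist k n) (cut_cluster k n t i)"
  shows "s = t"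
proof (rule PiE_ext)
  show "s b = t b" if "b \<in> {..<k div 2}" for b
  proof -
    have b: "b < k div 2"
      using that by simp
    then have "2 * b + 1 \<in> {1..k}"
      by auto
    then show ?thesis
      using eq[of "2 * b + 1"] cutsD(1)[OF s b] cutsD(1)[OF t b] n_pos
      unfolding radius_before_cut[OF s b] radius_before_cut[OF t b] by (auto split: if_splits)
  qed
qed (use s t in \<open>simp_all add: cuts_def\<close>)

section \<open>Counting cuts against outputs\<close>

lemma card_cuts: "card (cuts k n) = (block_length k n - 1) ^ (k div 2)"
  by (simp add: cuts_def card_PiE)

lemma finite_cuts: "finite (cuts k n)"
  by (auto simp: cuts_def intro: finite_PiE)

text \<open>Blocks of at least two points leave at least one place for each cut.\<close>

lemma cuts_nonempty: "cuts k n \<noteq> {}"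
  using card_cuts n by auto

text \<open>The bound holds because the radii determine the cut, so that on the event of success distinct
  cuts yield distinct outputs.\<close>

lemma learns_radii_cut_bound:
  assumes "learns_radii {..<n} (path_dist k n) k
    (map_pmf (cut_cluster k n) (pmf_of_set (cuts k n))) A q p"
  shows "p \<le> 2 ^ q / real ((block_length k n - 1) ^ (k div 2))"
proof -
  let ?scq = "\<lambda>s. same_cluster k (cut_cluster k n s)"
    and ?\<sigma> = "\<lambda>s. extreme_seed (cut_cluster k n s)"
  define E where
    "E = {(C, t). num_queries (same_cluster k C) (extreme_seed C) t \<le> q \<and>
       (\<forall>i\<in>{1..k}. result (same_cluster k C) (extreme_seed C) t i = radius {..<n} (path_dist k n) (C i))}"
  have "measure_pmf.prob (map_pmf (cut_cluster k n) (pmf_of_set (cuts k n))) {C. (C, t) \<in> E}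
    \<le> 2 ^ q / real ((block_length k n - 1) ^ (k div 2))" for t
  proof -
    \<comment> \<open>The cuts on which the fixed tree \<open>t\<close> succeeds; their share among
      all cuts is the success probability of \<open>t\<close>.\<close>
    define G where "G = {s \<in> cuts k n. (cut_cluster k n s, t) \<in> E}"
    have "inj_on (\<lambda>s. result (?scq s) (?\<sigma> s) t) G"
    proof (rule inj_onI)
      fix s s'
      assume "s \<in> G" "s' \<in> G" "result (?scq s) (?\<sigma> s) t = result (?scq s') (?\<sigma> s') t"
      then show "s = s'"
        by (intro cuts_eqI) (auto simp: G_def E_def)
    qed
    then have "card G = card ((\<lambda>s. result (?scq s) (?\<sigma> s) t) ` G)"
      by (simp add: card_image)
    also have "\<dots> \<le> card {result (?scq s) (?\<sigma> s) t |s. s \<in> UNIV \<and> num_queries (?scq s) (?\<sigma> s) t \<le> q}"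
      using two_answers_results[of UNIV ?\<sigma> ?scq t q] extreme_seed_two_answers[of k n]
      by (intro card_mono) (auto simp: G_def E_def)
    also have "\<dots> \<le> 2 ^ q"
      using two_answers_results[of UNIV ?\<sigma> ?scq t q] extreme_seed_two_answers[of k n] by auto
    finally have "real (card G) \<le> 2 ^ q"
      using of_nat_mono by fastforce
    moreover have "cuts k n \<inter> cut_cluster k n -` {C. (C, t) \<in> E} = G"
      by (auto simp: G_def)
    ultimately show ?thesis
      using finite_cuts cuts_nonempty
      by (simp add: measure_pmf_of_set card_cuts divide_right_mono)
  qed
  then have "measure_pmf.prob (pair_pmf (map_pmf (cut_cluster k n) (pmf_of_set (cuts k n))) A) E
    \<le> 2 ^ q / real ((block_length k n - 1) ^ (k div 2))"
    by (rule prob_pair_pmf_le)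
  \<comment> \<open>The guarantee covers every valid SEED oracle, in particular the
    adversary's.\<close>
  moreover have "p \<le> measure_pmf.prob (pair_pmf (map_pmf (cut_cluster k n) (pmf_of_set (cuts k n))) A) E"
    using assms[unfolded learns_radii_def, rule_format, of extreme_seed]
      seed_oracle_extreme_seed[of "cut_cluster k n _"] finite_cuts cuts_nonempty
    unfolding E_def by auto
  ultimately show ?thesis
    by linarith
qed

end

section \<open>The query bound\<close>

text \<open>There are at most \<open>k\<close> blocks, and rounding down costs at most one. The
  factor of about two lost here only affects the constant.\<close>

lemma block_length_ge:
  assumes "2 \<le> k"
  shows "real n / real k - 1 \<le> real (block_length k n)"
proof -
  have "n div k \<le> block_length k n"
    unfolding block_length_def using assms by (intro div_le_mono2) auto
  moreover have "real n / real k - 1 \<le> real (n div k)"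
    using floor_divide_of_nat_eq[of n k, where ?'a = real] by linarith
  ultimately show ?thesis
    by linarith
qed

text \<open>Taking logarithms, with \<open>x = n / k\<close>, the count of cuts contributes at least
  \<open>k * ln x / 6\<close>. At most half of this is spent on \<open>- ln p\<close>, which leaves
  the constant \<open>1 / 12\<close>.\<close>

lemma query_bound:
  fixes p :: real
  assumes k: "2 \<le> k" and p: "0 < p"
    and large: "4 \<le> real n / real k" "1 / p ^ 12 \<le> real n / real k"
    and bound: "p \<le> 2 ^ q / real ((block_length k n - 1) ^ (k div 2))"
  shows "1 / 12 * (real k * ln (real n / real k)) \<le> real q"
proof -
  define x where "x = real n / real k"
  have x: "4 \<le> x" "1 / p ^ 12 \<le> x"
    using large by (simp_all add: x_def)
  \<comment> \<open>The block length minus one is at least \<open>x - 2\<close>; its square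
    dominates \<open>x\<close> from \<open>x = 4\<close> on, which explains the threshold
    \<open>4\<close>.\<close>
  have "x \<le> (x - 2)\<^sup>2"
  proof -
    have "0 \<le> (x - 4) * (x - 1)"
      using x by (intro mult_nonneg_nonneg) auto
    then show ?thesis
      by (simp add: power2_eq_square algebra_simps)
  qed
  then have "ln x \<le> ln ((x - 2)\<^sup>2)"
    using x by simp
  also have "\<dots> = 2 * ln (x - 2)"
    using x by (simp add: ln_realpow)
  also have "\<dots> \<le> 2 * ln (real (block_length k n - 1))"
    using block_length_ge[OF k, of n] x by (auto simp: x_def[symmetric] of_nat_diff)
  finally have lnM: "ln x / 2 \<le> ln (real (block_length k n - 1))"
    by simp
  have M: "0 < real (block_length k n - 1)"
    using block_length_ge[OF k, of n] x by (simp add: x_def)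
  have lnx: "0 \<le> ln x"
    using x by simp
  \<comment> \<open>Rounding \<open>k / 2\<close> down loses the largest fraction at
    \<open>k = 3\<close>, where equality holds.\<close>
  have "k \<le> 3 * (k div 2)"
    using k by linarith
  then have "real k / 3 \<le> real (k div 2)"
    by linarith
  then have "real k / 3 * (ln x / 2) \<le> real (k div 2) * ln (real (block_length k n - 1))"
    using lnM lnx by (intro mult_mono) auto
  moreover have "p * real (block_length k n - 1) ^ (k div 2) \<le> 2 ^ q"
    using bound M by (simp add: pos_le_divide_eq)
  then have "ln (p * real (block_length k n - 1) ^ (k div 2)) \<le> ln (2 ^ q)"
    using p M by (subst ln_le_cancel_iff) auto
  then have "ln p + real (k div 2) * ln (real (block_length k n - 1)) \<le> real q * ln 2"
    using p M by (simp add: ln_mult ln_realpow)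
  moreover have "real q * ln 2 \<le> real q"
    using ln_2_less_1 by (simp add: mult_left_le)
  \<comment> \<open>The exponent \<open>12\<close> in the threshold is chosen so that
    \<open>- ln p\<close> is at most \<open>ln x / 12\<close>.\<close>
  moreover have "- (12 * ln p) \<le> ln x"
  proof -
    have "ln (1 / p ^ 12) \<le> ln x"
      using x p by (subst ln_le_cancel_iff) auto
    then show ?thesis
      using p by (simp add: ln_div ln_realpow)
  qed
  moreover have "ln x \<le> real k * ln x"
    using lnx k by (simp add: mult_le_cancel_right1)
  ultimately show ?thesis
    unfolding x_def[symmetric] by (simp add: field_simps)
qed

text \<open>Space, distances and distribution are fixed before \<open>p\<close>, and
  \<open>c = 1/12\<close> serves for every \<open>p\<close>; the success probability enters only
  through the threshold on \<open>n\<close>.\<close>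

theorem theorem16:
  "\<exists>(X :: nat \<Rightarrow> nat \<Rightarrow> nat set) (d :: nat \<Rightarrow> nat \<Rightarrow> nat \<Rightarrow> nat \<Rightarrow> ereal)
      (D :: nat \<Rightarrow> nat \<Rightarrow> (nat \<Rightarrow> nat set) pmf).
    \<forall>p::real. 0 < p \<and> p \<le> 1 \<longrightarrow>
     (\<exists>c::real. c > 0 \<and>
       (\<forall>k::nat. k \<ge> 2 \<longrightarrow> (\<exists>n\<^sub>0::nat. \<forall>n\<ge>n\<^sub>0.
          finite (X k n) \<and> card (X k n) = n \<and> semimetric (X k n) (d k n) \<and>
          (\<forall>C\<in>set_pmf (D k n).
             clustering (X k n) k C \<and>
             uniform_convex (X k n) (d k n) (1/2) 1 k C \<and>
             generalized_convex (X k n) (d k n) (1/2) 1 k C) \<and>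
          (\<forall>(A :: (nat, nat \<Rightarrow> real) algorithm pmf) (q::nat).
             (\<forall>t\<in>set_pmf A. admissible (X k n) k t) \<and>
             learns_radii (X k n) (d k n) k (D k n) A q p
             \<longrightarrow> c * (real k * ln (real n / real k)) \<le> real q))))"
proof (rule exI[of _ "\<lambda>k n. {..<n}"], rule exI[of _ path_dist],
    rule exI[of _ "\<lambda>k n. map_pmf (cut_cluster k n) (pmf_of_set (cuts k n))"], intro allI impI)
  fix p :: real
  assume p: "0 < p \<and> p \<le> 1"
  show "\<exists>c>0. \<forall>k\<ge>2. \<exists>n\<^sub>0. \<forall>n\<ge>n\<^sub>0.
      finite {..<n} \<and> card {..<n} = n \<and> semimetric {..<n} (path_dist k n) \<and>
      (\<forall>C\<in>set_pmf (map_pmf (cut_cluster k n) (pmf_of_set (cuts k n))).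
         clustering {..<n} k C \<and>
         uniform_convex {..<n} (path_dist k n) (1/2) 1 k C \<and>
         generalized_convex {..<n} (path_dist k n) (1/2) 1 k C) \<and>
      (\<forall>(A :: (nat, nat \<Rightarrow> real) algorithm pmf) q.
         (\<forall>t\<in>set_pmf A. admissible {..<n} k t) \<and>
         learns_radii {..<n} (path_dist k n) k
           (map_pmf (cut_cluster k n) (pmf_of_set (cuts k n))) A q p
         \<longrightarrow> c * (real k * ln (real n / real k)) \<le> real q)"
  proof (intro exI[of _ "1/12 :: real"] conjI allI impI)
    fix k :: nat
    assume k: "2 \<le> k"
    show "\<exists>n\<^sub>0. \<forall>n\<ge>n\<^sub>0.
      finite {..<n} \<and> card {..<n} = n \<and> semimetric {..<n} (path_dist k n) \<and>
      (\<forall>C\<in>set_pmf (map_pmf (cut_cluster k n) (pmf_of_set (cuts k n))).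
         clustering {..<n} k C \<and>
         uniform_convex {..<n} (path_dist k n) (1/2) 1 k C \<and>
         generalized_convex {..<n} (path_dist k n) (1/2) 1 k C) \<and>
      (\<forall>(A :: (nat, nat \<Rightarrow> real) algorithm pmf) q.
         (\<forall>t\<in>set_pmf A. admissible {..<n} k t) \<and>
         learns_radii {..<n} (path_dist k n) k
           (map_pmf (cut_cluster k n) (pmf_of_set (cuts k n))) A q p
         \<longrightarrow> 1/12 * (real k * ln (real n / real k)) \<le> real q)"
    \<comment> \<open>The sum of the two lower bounds on \<open>n / k\<close> secures both at
      once.\<close>
    proof (rule exI[of _ "nat \<lceil>real k * (4 + 1 / p ^ 12)\<rceil>"], intro allI impI)
      fix n
      assume "nat \<lceil>real k * (4 + 1 / p ^ 12)\<rceil> \<le> n"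
      then have "real k * (4 + 1 / p ^ 12) \<le> real n"
        by linarith
      then have "4 + 1 / p ^ 12 \<le> real n / real k"
        using k by (simp add: pos_le_divide_eq mult.commute)
      moreover have "0 < 1 / p ^ 12"
        using p by simp
      ultimately have large: "4 \<le> real n / real k" "1 / p ^ 12 \<le> real n / real k"
        by linarith+
      \<comment> \<open>From \<open>n / k \<ge> 4\<close> the block length is even at least
        \<open>3\<close>.\<close>
      have "2 \<le> block_length k n"
        using block_length_ge[OF k, of n] large by linarith
      then interpret cut_paths k n
        by unfold_locales (rule k)
      have "set_pmf (map_pmf (cut_cluster k n) (pmf_of_set (cuts k n))) = cut_cluster k n ` cuts k n"
        using finite_cuts cuts_nonempty by simp
      then show "finite {..<n} \<and> card {..<n} = n \<and> semimetric {..<n} (path_dist k n) \<and>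
      (\<forall>C\<in>set_pmf (map_pmf (cut_cluster k n) (pmf_of_set (cuts k n))).
         clustering {..<n} k C \<and>
         uniform_convex {..<n} (path_dist k n) (1/2) 1 k C \<and>
         generalized_convex {..<n} (path_dist k n) (1/2) 1 k C) \<and>
      (\<forall>(A :: (nat, nat \<Rightarrow> real) algorithm pmf) q.
         (\<forall>t\<in>set_pmf A. admissible {..<n} k t) \<and>
         learns_radii {..<n} (path_dist k n) k
           (map_pmf (cut_cluster k n) (pmf_of_set (cuts k n))) A q p
         \<longrightarrow> 1/12 * (real k * ln (real n / real k)) \<le> real q)"
        using semimetric_path_dist clustering_cut_cluster uniform_convex_cut_cluster
          generalized_convex_cut_cluster query_bound[OF k _ large learns_radii_cut_bound] p
        by (intro conjI allI impI) (simp_all only: finite_lessThan card_lessThan, blast+)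
    qed
  qed simp
qed

end
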